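(* Let $\mathbf{P}$ be an additive category and let $\overline{\alpha}: (A \xrightarrow{\gamma_A} \Omega_A \xleftarrow{\rho_A} R_A) \to (B \xrightarrow{\gamma_B} \Omega_B \xleftarrow{\rho_B} R_B)$ be a morphism in $\mathcal{Q}(\mathbf{P})$. Then $\mathrm{id}_B$ defines a well-defined morphism in $\mathcal{Q}(\mathbf{P})$ $$\overline{\mathrm{id}_B}: (B \xrightarrow{\gamma_B} \Omega_B \xleftarrow{\rho_B} R_B) \longrightarrow \left(B \xrightarrow{\gamma_B} \Omega_B \xleftarrow{\begin{pmatrix}\rho_B \\ \alpha\cdot\gamma_B\end{pmatrix}} R_B \oplus A\right)$$ which is a cokernel projection of $\overline{\alpha}$. Moreover, for every morphism $\overline{\tau}: (B \xrightarrow{\gamma_B} \Omega_B \xleftarrow{\rho_B} R_B) \to (T \xrightarrow{\gamma_T} \Omega_T \xleftarrow{\rho_T} R_T)$ in $\mathcal{Q}(\mathbf{P})$ with $\overline{\alpha}\cdot\overline{\tau} = 0$, the unique morphism from the cokernel object to $(T \xrightarrow{\gamma_T} \Omega_T \xleftarrow{\rho_T} R_T)$ induced by the universal property is represented by $\tau: B \to T$.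
   Context: Composition is written diagrammatically: for $\alpha: A \to B$ and $\beta: B \to C$, the composite is $\alpha\cdot\beta: A \to C$. Morphisms between direct sums use the row convention: $\begin{pmatrix}\rho_1 \\ \rho_2\end{pmatrix}: X_1\oplus X_2 \to Y$ has components $\rho_i: X_i \to Y$. A cospan in $\mathbf{P}$ is a pair of morphisms $(A \xrightarrow{\gamma} B \xleftarrow{\rho} C)$ with common codomain. $\mathrm{Syz}(A \xrightarrow{\gamma} B \xleftarrow{\rho} C)$ is the full subcategory of the slice category of $\mathbf{P}$ over $A$ whose objects, called syzygies, are the morphisms $\sigma: S \to A$ for which there exists $\omega: S \to C$ (a syzygy witness) with $\sigma\cdot\gamma = \omega\cdot\rho$. The additive category $\mathrm{Aux}(\mathbf{P})$ has as objects the cospans $(A \xrightarrow{\gamma_A} \Omega_A \xleftarrow{\rho_A} R_A)$ in $\mathbf{P}$; a morphism from $(A \xrightarrow{\gamma_A} \Omega_A \xleftarrow{\rho_A} R_A)$ to $(B \xrightarrow{\gamma_B} \Omega_B \xleftarrow{\rho_B} R_B)$ is a morphism $\alpha: A \to B$ in $\mathbf{P}$ satisfying the well-definedness property: $\sigma \in \mathrm{Syz}(A \xrightarrow{\gamma_A} \Omega_A \xleftarrow{\rho_A} R_A)$ implies $\sigma\cdot\alpha \in \mathrm{Syz}(B \xrightarrow{\gamma_B} \Omega_B \xleftarrow{\rho_B} R_B)$; composition and identities are those of $\mathbf{P}$. The ideal $\mathbf{I}(\mathbf{P})$ of $\mathrm{Aux}(\mathbf{P})$ consists of the morphisms $\alpha$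 (notation as before) for which there exists $\zeta: A \to R_B$ with $\alpha\cdot\gamma_B = \zeta\cdot\rho_B$. $\mathcal{Q}(\mathbf{P}) := \mathrm{Aux}(\mathbf{P})/\mathbf{I}(\mathbf{P})$ is the additive quotient category; the class of a morphism $\alpha$ of $\mathrm{Aux}(\mathbf{P})$ is denoted $\overline{\alpha}$. *)

theory Defs
  imports "HOL-Algebra.Coset"
begin

section \<open>Categories\<close>

text \<open>
  A category is given by a set of objects and a family of hom-sets.  Hom-sets for different pairs
  of objects need not be disjoint, so composition and identities (and later addition and zero)
  carry the objects involved as arguments.  Composition is diagrammatic: for
  \<open>f\<close> from \<open>A\<close> to \<open>B\<close> and \<open>g\<close> from \<open>B\<close> to \<open>D\<close>, the morphism \<open>Comp C A B D f g\<close> is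
  ``first \<open>f\<close>, then \<open>g\<close>''.
\<close>

record ('o, 'm) cat =
  Obj :: "'o set"
  Hom :: "'o \<Rightarrow> 'o \<Rightarrow> 'm set"
  Ident :: "'o \<Rightarrow> 'm"
  Comp :: "'o \<Rightarrow> 'o \<Rightarrow> 'o \<Rightarrow> 'm \<Rightarrow> 'm \<Rightarrow> 'm"

locale category =
  fixes C :: "('o, 'm, 'x) cat_scheme"
  assumes Ident_closed: "A \<in> Obj C \<Longrightarrow> Ident C A \<in> Hom C A A"
    and Comp_closed:
      "\<lbrakk>A \<in> Obj C; B \<in> Obj C; D \<in> Obj C; f \<in> Hom C A B; g \<in> Hom C B D\<rbrakk>
        \<Longrightarrow> Comp C A B D f g \<in> Hom C A D"
    and Comp_assoc:
      "\<lbrakk>A \<in> Obj C; B \<in> Obj C; D \<in> Obj C; E \<in> Obj C;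
        f \<in> Hom C A B; g \<in> Hom C B D; h \<in> Hom C D E\<rbrakk>
        \<Longrightarrow> Comp C A D E (Comp C A B D f g) h = Comp C A B E f (Comp C B D E g h)"
    and Ident_left:
      "\<lbrakk>A \<in> Obj C; B \<in> Obj C; f \<in> Hom C A B\<rbrakk> \<Longrightarrow> Comp C A A B (Ident C A) f = f"
    and Ident_right:
      "\<lbrakk>A \<in> Obj C; B \<in> Obj C; f \<in> Hom C A B\<rbrakk> \<Longrightarrow> Comp C A B B f (Ident C B) = f"

definition slice_category :: "('o, 'm, 'x) cat_scheme \<Rightarrow> 'o \<Rightarrow> ('o \<times> 'm, 'm) cat" where
  "slice_category C A = \<lparr>
     Obj = {(S, \<sigma>). S \<in> Obj C \<and> \<sigma> \<in> Hom C S A},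
     Hom = (\<lambda>(S, \<sigma>) (S', \<sigma>'). {f \<in> Hom C S S'. Comp C S S' A f \<sigma>' = \<sigma>}),
     Ident = (\<lambda>(S, \<sigma>). Ident C S),
     Comp = (\<lambda>(S, \<sigma>) (S', \<sigma>') (S'', \<sigma>''). Comp C S S' S'') \<rparr>"

definition full_subcategory :: "('o, 'm) cat \<Rightarrow> 'o set \<Rightarrow> ('o, 'm) cat" where
  "full_subcategory C U = C\<lparr>Obj := Obj C \<inter> U\<rparr>"


section \<open>Additive categories\<close>

record ('o, 'm) preadd_cat = "('o, 'm) cat" +
  Add :: "'o \<Rightarrow> 'o \<Rightarrow> 'm \<Rightarrow> 'm \<Rightarrow> 'm"
  Zero :: "'o \<Rightarrow> 'o \<Rightarrow> 'm"

text \<open>The multiplicative notation of \<^theory>\<open>HOL-Algebra.Coset\<close> stands for addition of morphisms.\<close>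

definition hom_group :: "('o, 'm, 'x) preadd_cat_scheme \<Rightarrow> 'o \<Rightarrow> 'o \<Rightarrow> 'm monoid" where
  "hom_group C A B = \<lparr>carrier = Hom C A B, monoid.mult = Add C A B, one = Zero C A B\<rparr>"

locale preadditive_category = category C
  for C :: "('o, 'm, 'x) preadd_cat_scheme" +
  assumes hom_comm_group: "\<lbrakk>A \<in> Obj C; B \<in> Obj C\<rbrakk> \<Longrightarrow> comm_group (hom_group C A B)"
    and Comp_Add_left:
      "\<lbrakk>A \<in> Obj C; B \<in> Obj C; D \<in> Obj C; f \<in> Hom C A B; g \<in> Hom C A B; h \<in> Hom C B D\<rbrakk>
        \<Longrightarrow> Comp C A B D (Add C A B f g) h = Add C A D (Comp C A B D f h) (Comp C A B D g h)"
    and Comp_Add_right: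
      "\<lbrakk>A \<in> Obj C; B \<in> Obj C; D \<in> Obj C; f \<in> Hom C A B; g \<in> Hom C B D; h \<in> Hom C B D\<rbrakk>
        \<Longrightarrow> Comp C A B D f (Add C B D g h) = Add C A D (Comp C A B D f g) (Comp C A B D f h)"

definition is_zero_object :: "('o, 'm, 'x) cat_scheme \<Rightarrow> 'o \<Rightarrow> bool" where
  "is_zero_object C Z \<longleftrightarrow> Z \<in> Obj C \<and>
     (\<forall>A \<in> Obj C. (\<exists>!f. f \<in> Hom C A Z) \<and> (\<exists>!f. f \<in> Hom C Z A))"

definition is_direct_sum ::
  "('o, 'm, 'x) preadd_cat_scheme \<Rightarrow> 'o \<Rightarrow> 'o \<Rightarrow> 'o \<Rightarrow> 'm \<Rightarrow> 'm \<Rightarrow> 'm \<Rightarrow> 'm \<Rightarrow> bool" where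
  "is_direct_sum C X1 X2 D i1 i2 p1 p2 \<longleftrightarrow>
     D \<in> Obj C \<and>
     i1 \<in> Hom C X1 D \<and> i2 \<in> Hom C X2 D \<and> p1 \<in> Hom C D X1 \<and> p2 \<in> Hom C D X2 \<and>
     Comp C X1 D X1 i1 p1 = Ident C X1 \<and> Comp C X2 D X2 i2 p2 = Ident C X2 \<and>
     Comp C X1 D X2 i1 p2 = Zero C X1 X2 \<and> Comp C X2 D X1 i2 p1 = Zero C X2 X1 \<and>
     Add C D D (Comp C D X1 D p1 i1) (Comp C D X2 D p2 i2) = Ident C D"

locale additive_category = preadditive_category C
  for C :: "('o, 'm, 'x) preadd_cat_scheme" +
  assumes ex_zero_object: "\<exists>Z. is_zero_object C Z"
    and ex_direct_sum:
      "\<lbrakk>X1 \<in> Obj C; X2 \<in> Obj C\<rbrakk> \<Longrightarrow> \<exists>D i1 i2 p1 p2. is_direct_sum C X1 X2 D i1 i2 p1 p2"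

text \<open>
  The morphism from the direct sum \<open>D\<close> of \<open>X1\<close> and \<open>X2\<close> to \<open>Y\<close> with components \<open>f1\<close> and \<open>f2\<close>
  (\<open>f1\<close> stacked on \<open>f2\<close> in the row convention);
  \<open>i1\<close> and \<open>i2\<close> are the injections into \<open>D\<close>.
\<close>

definition row_morphism ::
  "('o, 'm, 'x) cat_scheme \<Rightarrow> 'o \<Rightarrow> 'o \<Rightarrow> 'o \<Rightarrow> 'm \<Rightarrow> 'm \<Rightarrow> 'o \<Rightarrow> 'm \<Rightarrow> 'm \<Rightarrow> 'm" where
  "row_morphism C X1 X2 D i1 i2 Y f1 f2 =
     (THE h. h \<in> Hom C D Y \<and> Comp C X1 D Y i1 h = f1 \<and> Comp C X2 D Y i2 h = f2)"

definition is_cokernel ::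
  "('o, 'm, 'x) preadd_cat_scheme \<Rightarrow> 'o \<Rightarrow> 'o \<Rightarrow> 'm \<Rightarrow> 'o \<Rightarrow> 'm \<Rightarrow> bool" where
  "is_cokernel C A B \<alpha> K \<pi> \<longleftrightarrow>
     K \<in> Obj C \<and> \<pi> \<in> Hom C B K \<and> Comp C A B K \<alpha> \<pi> = Zero C A K \<and>
     (\<forall>T \<in> Obj C. \<forall>\<tau> \<in> Hom C B T. Comp C A B T \<alpha> \<tau> = Zero C A T \<longrightarrow>
        (\<exists>!u. u \<in> Hom C K T \<and> Comp C B K T \<pi> u = \<tau>))"


section \<open>Quotients by ideals\<close>

text \<open>
  The class of a morphism is its coset modulo \<open>I A B\<close>.  The composite of two classes is the union
  of the classes of all composites of representatives; if \<open>I\<close> is an ideal, all of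
  these classes agree.
\<close>

definition quotient_class ::
  "('o, 'm, 'x) preadd_cat_scheme \<Rightarrow> ('o \<Rightarrow> 'o \<Rightarrow> 'm set) \<Rightarrow> 'o \<Rightarrow> 'o \<Rightarrow> 'm \<Rightarrow> 'm set" where
  "quotient_class C I A B f = I A B #>\<^bsub>hom_group C A B\<^esub> f"

definition quotient_category ::
  "('o, 'm, 'x) preadd_cat_scheme \<Rightarrow> ('o \<Rightarrow> 'o \<Rightarrow> 'm set) \<Rightarrow> ('o, 'm set) preadd_cat" where
  "quotient_category C I = \<lparr>
     Obj = Obj C,
     Hom = (\<lambda>A B. carrier (hom_group C A B Mod I A B)),
     Ident = (\<lambda>A. quotient_class C I A A (Ident C A)),
     Comp = (\<lambda>A B D F G. \<Union>f \<in> F. \<Union>g \<in> G. quotient_class C I A D (Comp C A B D f g)),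
     Add = (\<lambda>A B. monoid.mult (hom_group C A B Mod I A B)),
     Zero = (\<lambda>A B. one (hom_group C A B Mod I A B)) \<rparr>"


section \<open>Cospans, syzygies and the category \<open>Q(P)\<close>\<close>

text \<open>\<open>Cospan A \<Omega> R \<gamma> \<rho>\<close> is the cospan with \<open>\<gamma>\<close> from \<open>A\<close> to \<open>\<Omega>\<close> and \<open>\<rho>\<close> from \<open>R\<close> to \<open>\<Omega>\<close>.\<close>

datatype ('o, 'm) cospan =
  Cospan (csrc: 'o) (capex: 'o) (crel: 'o) (cgamma: 'm) (crho: 'm)

definition cospans :: "('o, 'm, 'x) cat_scheme \<Rightarrow> ('o, 'm) cospan set" where
  "cospans P = {Cospan A \<Omega> R \<gamma> \<rho> | A \<Omega> R \<gamma> \<rho>.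
     A \<in> Obj P \<and> \<Omega> \<in> Obj P \<and> R \<in> Obj P \<and> \<gamma> \<in> Hom P A \<Omega> \<and> \<rho> \<in> Hom P R \<Omega>}"

definition Syz :: "('o, 'm, 'x) cat_scheme \<Rightarrow> ('o, 'm) cospan \<Rightarrow> ('o \<times> 'm, 'm) cat" where
  "Syz P X = full_subcategory (slice_category P (csrc X))
     {(S, \<sigma>). \<exists>\<omega> \<in> Hom P S (crel X).
        Comp P S (csrc X) (capex X) \<sigma> (cgamma X) = Comp P S (crel X) (capex X) \<omega> (crho X)}"

definition Aux ::
  "('o, 'm, 'x) preadd_cat_scheme \<Rightarrow> (('o, 'm) cospan, 'm) preadd_cat" where
  "Aux P = \<lparr>
     Obj = cospans P,
     Hom = (\<lambda>X Y. {\<alpha> \<in> Hom P (csrc X) (csrc Y). \<forall>S \<sigma>.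
        (S, \<sigma>) \<in> Obj (Syz P X) \<longrightarrow> (S, Comp P S (csrc X) (csrc Y) \<sigma> \<alpha>) \<in> Obj (Syz P Y)}),
     Ident = (\<lambda>X. Ident P (csrc X)),
     Comp = (\<lambda>X Y Z. Comp P (csrc X) (csrc Y) (csrc Z)),
     Add = (\<lambda>X Y. Add P (csrc X) (csrc Y)),
     Zero = (\<lambda>X Y. Zero P (csrc X) (csrc Y)) \<rparr>"

definition aux_ideal ::
  "('o, 'm, 'x) preadd_cat_scheme \<Rightarrow> ('o, 'm) cospan \<Rightarrow> ('o, 'm) cospan \<Rightarrow> 'm set" where
  "aux_ideal P X Y = {\<alpha> \<in> Hom (Aux P) X Y. \<exists>\<zeta> \<in> Hom P (csrc X) (crel Y).
     Comp P (csrc X) (csrc Y) (capex Y) \<alpha> (cgamma Y) =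
     Comp P (csrc X) (crel Y) (capex Y) \<zeta> (crho Y)}"

definition Q :: "('o, 'm, 'x) preadd_cat_scheme \<Rightarrow> (('o, 'm) cospan, 'm set) preadd_cat" where
  "Q P = quotient_category (Aux P) (aux_ideal P)"

definition Q_class ::
  "('o, 'm, 'x) preadd_cat_scheme \<Rightarrow> ('o, 'm) cospan \<Rightarrow> ('o, 'm) cospan \<Rightarrow> 'm \<Rightarrow> 'm set" where
  "Q_class P X Y \<alpha> = quotient_class (Aux P) (aux_ideal P) X Y \<alpha>"

end

theory Submission
  imports Defs
begin

text \<open>
  A morphism out of \<open>A\<close> lies in the ideal exactly when it is a syzygy of its target cospan; in
  particular membership does not depend on the cospan chosen for its source.  Hence classes from
  \<open>Y\<close> and from \<open>K\<close>, which both have \<open>B\<close> as underlying object, are compared in the same way, and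
  uniqueness of the induced morphism is immediate.  For existence, let \<open>\<sigma>\<close> be a syzygy of \<open>K\<close> with
  witness \<open>\<omega>\<close>, whose components are \<open>\<omega>\<^sub>1\<close> and \<open>\<omega>\<^sub>2\<close>.  Then \<open>\<sigma> - \<omega>\<^sub>2 \<cdot> \<alpha>\<close> is a syzygy of \<open>Y\<close> with
  witness \<open>\<omega>\<^sub>1\<close>, and \<open>\<tau>\<close> sends it to a syzygy of \<open>T\<close>; since \<open>\<alpha> \<cdot> \<tau>\<close> is itself a syzygy of \<open>T\<close>, so
  is \<open>\<sigma> \<cdot> \<tau>\<close>.
\<close>

section \<open>Hom groups and morphisms out of direct sums\<close>

context preadditive_category
begin

lemma hom_group_simps [simp]:
  "carrier (hom_group C A B) = Hom C A B"
  "monoid.mult (hom_group C A B) = Add C A B"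
  "one (hom_group C A B) = Zero C A B"
  by (simp_all add: hom_group_def)

lemma hom_group_is_group:
  assumes "A \<in> Obj C" "B \<in> Obj C"
  shows "group (hom_group C A B)"
  using hom_comm_group[OF assms] by (simp add: comm_group_def)

lemma Add_closed:
  assumes "A \<in> Obj C" "B \<in> Obj C" "f \<in> Hom C A B" "g \<in> Hom C A B"
  shows "Add C A B f g \<in> Hom C A B"
  using monoid.m_closed[OF group.is_monoid[OF hom_group_is_group[OF assms(1,2)]]] assms by simp

lemma Add_assoc:
  assumes "A \<in> Obj C" "B \<in> Obj C" "f \<in> Hom C A B" "g \<in> Hom C A B" "h \<in> Hom C A B"
  shows "Add C A B (Add C A B f g) h = Add C A B f (Add C A B g h)"
  using monoid.m_assoc[OF group.is_monoid[OF hom_group_is_group[OF assms(1,2)]]] assms by simp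

lemma Zero_closed:
  assumes "A \<in> Obj C" "B \<in> Obj C"
  shows "Zero C A B \<in> Hom C A B"
  using monoid.one_closed[OF group.is_monoid[OF hom_group_is_group[OF assms(1,2)]]] by simp

lemma Add_Zero_left:
  assumes "A \<in> Obj C" "B \<in> Obj C" "f \<in> Hom C A B"
  shows "Add C A B (Zero C A B) f = f"
  using monoid.l_one[OF group.is_monoid[OF hom_group_is_group[OF assms(1,2)]]] assms by simp

lemma Add_Zero_right:
  assumes "A \<in> Obj C" "B \<in> Obj C" "f \<in> Hom C A B"
  shows "Add C A B f (Zero C A B) = f"
  using monoid.r_one[OF group.is_monoid[OF hom_group_is_group[OF assms(1,2)]]] assms by simp

text \<open>Bilinearity of composition is packaged as group homomorphisms, here and in
  \<open>group_hom_postcomp\<close>, so that preservation of zero and of negatives follows from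
  general group theory.\<close>

lemma group_hom_precomp:
  assumes "A \<in> Obj C" "B \<in> Obj C" "D \<in> Obj C" "f \<in> Hom C A B"
  shows "group_hom (hom_group C B D) (hom_group C A D) (Comp C A B D f)"
  using assms
  by (intro group_hom.intro group_hom_axioms.intro homI)
    (simp_all add: hom_group_is_group Comp_closed Comp_Add_right)

lemma group_hom_postcomp:
  assumes "A \<in> Obj C" "B \<in> Obj C" "D \<in> Obj C" "h \<in> Hom C B D"
  shows "group_hom (hom_group C A B) (hom_group C A D) (\<lambda>f. Comp C A B D f h)"
  using assms
  by (intro group_hom.intro group_hom_axioms.intro homI)
    (simp_all add: hom_group_is_group Comp_closed Comp_Add_left)

text \<open>Since \<open>row_morphism\<close> is a definite description, its properties rest on
  unique existence. The candidate is \<open>p1\<close> followed by \<open>f1\<close> plus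
  \<open>p2\<close> followed by \<open>f2\<close>. Any other solution equals it after precomposing
  with the decomposition of the identity of \<open>D\<close>.\<close>

lemma row_morphism:
  assumes X: "X1 \<in> Obj C" "X2 \<in> Obj C" "Y \<in> Obj C"
    and sum: "is_direct_sum C X1 X2 D i1 i2 p1 p2"
    and f: "f1 \<in> Hom C X1 Y" "f2 \<in> Hom C X2 Y"
  shows row_morphism_closed: "row_morphism C X1 X2 D i1 i2 Y f1 f2 \<in> Hom C D Y"
    and inj1_row_morphism: "Comp C X1 D Y i1 (row_morphism C X1 X2 D i1 i2 Y f1 f2) = f1"
    and inj2_row_morphism: "Comp C X2 D Y i2 (row_morphism C X1 X2 D i1 i2 Y f1 f2) = f2"
proof -
  have D: "D \<in> Obj C" "i1 \<in> Hom C X1 D" "i2 \<in> Hom C X2 D" "p1 \<in> Hom C D X1" "p2 \<in> Hom C D X2"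
    and ip: "Comp C X1 D X1 i1 p1 = Ident C X1" "Comp C X2 D X2 i2 p2 = Ident C X2"
      "Comp C X1 D X2 i1 p2 = Zero C X1 X2" "Comp C X2 D X1 i2 p1 = Zero C X2 X1"
    and pi: "Add C D D (Comp C D X1 D p1 i1) (Comp C D X2 D p2 i2) = Ident C D"
    using sum by (auto simp: is_direct_sum_def)
  note closed = X D f Comp_closed Add_closed
  have Zero_Comp: "Comp C A B Y (Zero C A B) f = Zero C A Y"
    if "A \<in> Obj C" "B \<in> Obj C" "f \<in> Hom C B Y" for A B f
    using group_hom.hom_one[OF group_hom_postcomp[OF that(1,2) X(3) that(3)]] by simp
  let ?P = "\<lambda>h. h \<in> Hom C D Y \<and> Comp C X1 D Y i1 h = f1 \<and> Comp C X2 D Y i2 h = f2"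
  let ?h = "Add C D Y (Comp C D X1 Y p1 f1) (Comp C D X2 Y p2 f2)"
  have "?P ?h"
  proof (intro conjI)
    show "?h \<in> Hom C D Y" by (simp add: closed)
    have "Comp C X1 D Y i1 ?h
        = Add C X1 Y (Comp C X1 X1 Y (Comp C X1 D X1 i1 p1) f1)
            (Comp C X1 X2 Y (Comp C X1 D X2 i1 p2) f2)"
      using Comp_assoc[of X1 D X1 Y i1 p1 f1] Comp_assoc[of X1 D X2 Y i1 p2 f2]
      by (simp add: closed Comp_Add_right)
    then show "Comp C X1 D Y i1 ?h = f1"
      by (simp add: ip Ident_left Zero_Comp Add_Zero_right X f)
    have "Comp C X2 D Y i2 ?h
        = Add C X2 Y (Comp C X2 X1 Y (Comp C X2 D X1 i2 p1) f1)
            (Comp C X2 X2 Y (Comp C X2 D X2 i2 p2) f2)"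
      using Comp_assoc[of X2 D X1 Y i2 p1 f1] Comp_assoc[of X2 D X2 Y i2 p2 f2]
      by (simp add: closed Comp_Add_right)
    then show "Comp C X2 D Y i2 ?h = f2"
      by (simp add: ip Ident_left Zero_Comp Add_Zero_left X f)
  qed
  moreover have "h = ?h" if "?P h" for h
  proof -
    have h: "h \<in> Hom C D Y" using that by blast
    have "h = Comp C D D Y (Add C D D (Comp C D X1 D p1 i1) (Comp C D X2 D p2 i2)) h"
      by (simp add: pi Ident_left closed h)
    also have "\<dots> = Add C D Y (Comp C D X1 Y p1 (Comp C X1 D Y i1 h))
        (Comp C D X2 Y p2 (Comp C X2 D Y i2 h))"
      using Comp_assoc[of D X1 D Y p1 i1 h] Comp_assoc[of D X2 D Y p2 i2 h]
      by (simp add: closed Comp_Add_left h)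
    finally show ?thesis using that by simp
  qed
  ultimately have "?P (row_morphism C X1 X2 D i1 i2 Y f1 f2)"
    unfolding row_morphism_def by (rule theI[where P = ?P])
  then show "row_morphism C X1 X2 D i1 i2 Y f1 f2 \<in> Hom C D Y"
    and "Comp C X1 D Y i1 (row_morphism C X1 X2 D i1 i2 Y f1 f2) = f1"
    and "Comp C X2 D Y i2 (row_morphism C X1 X2 D i1 i2 Y f1 f2) = f2"
    by blast+
qed

text \<open>This splits a witness into the relation object of the cokernel cospan into its two
  components. It follows by writing the row morphism itself as the sum of its components along
  \<open>p1\<close> and \<open>p2\<close>.\<close>

lemma Comp_row_morphism:
  assumes "X1 \<in> Obj C" "X2 \<in> Obj C" "Y \<in> Obj C" "S \<in> Obj C"
    and sum: "is_direct_sum C X1 X2 D i1 i2 p1 p2"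
    and f: "f1 \<in> Hom C X1 Y" "f2 \<in> Hom C X2 Y" and w: "w \<in> Hom C S D"
  shows "Comp C S D Y w (row_morphism C X1 X2 D i1 i2 Y f1 f2) =
    Add C S Y (Comp C S X1 Y (Comp C S D X1 w p1) f1) (Comp C S X2 Y (Comp C S D X2 w p2) f2)"
proof -
  have D: "D \<in> Obj C" "i1 \<in> Hom C X1 D" "i2 \<in> Hom C X2 D" "p1 \<in> Hom C D X1" "p2 \<in> Hom C D X2"
    and pi: "Add C D D (Comp C D X1 D p1 i1) (Comp C D X2 D p2 i2) = Ident C D"
    using sum by (auto simp: is_direct_sum_def)
  let ?r = "row_morphism C X1 X2 D i1 i2 Y f1 f2"
  note r = row_morphism[OF assms(1-3) sum f]
  note closed = assms D r(1) Comp_closed Add_closed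
  have "?r = Comp C D D Y (Add C D D (Comp C D X1 D p1 i1) (Comp C D X2 D p2 i2)) ?r"
    by (simp add: pi Ident_left closed)
  also have "\<dots> = Add C D Y (Comp C D X1 Y p1 f1) (Comp C D X2 Y p2 f2)"
    by (simp add: Comp_Add_left Comp_assoc closed r(2,3))
  finally have "Comp C S D Y w ?r = Comp C S D Y w \<dots>" by simp
  also have "\<dots> = Add C S Y (Comp C S X1 Y (Comp C S D X1 w p1) f1)
      (Comp C S X2 Y (Comp C S D X2 w p2) f2)"
    by (simp add: Comp_Add_right Comp_assoc closed)
  finally show ?thesis .
qed

end


section \<open>Quotients by ideals\<close>

locale category_ideal = preadditive_category C
  for C :: "('o, 'm, 'x) preadd_cat_scheme" +
  fixes I :: "'o \<Rightarrow> 'o \<Rightarrow> 'm set"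
  assumes subgroup_ideal: "\<lbrakk>A \<in> Obj C; B \<in> Obj C\<rbrakk> \<Longrightarrow> subgroup (I A B) (hom_group C A B)"
    and Comp_ideal_left:
      "\<lbrakk>A \<in> Obj C; B \<in> Obj C; D \<in> Obj C; f \<in> I A B; g \<in> Hom C B D\<rbrakk>
        \<Longrightarrow> Comp C A B D f g \<in> I A D"
    and Comp_ideal_right:
      "\<lbrakk>A \<in> Obj C; B \<in> Obj C; D \<in> Obj C; f \<in> Hom C A B; g \<in> I B D\<rbrakk>
        \<Longrightarrow> Comp C A B D f g \<in> I A D"
begin

lemma ideal_subset:
  assumes "A \<in> Obj C" "B \<in> Obj C" "f \<in> I A B"
  shows "f \<in> Hom C A B"
  using subgroup.mem_carrier[OF subgroup_ideal] assms by simp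

lemma ideal_Add_closed:
  assumes "A \<in> Obj C" "B \<in> Obj C" "f \<in> I A B" "g \<in> I A B"
  shows "Add C A B f g \<in> I A B"
  using subgroup.m_closed[OF subgroup_ideal] assms by simp

lemma mem_quotient_class_iff:
  "f \<in> quotient_class C I A B g \<longleftrightarrow> (\<exists>i \<in> I A B. f = Add C A B i g)"
  by (simp add: quotient_class_def r_coset_def)

lemma quotient_class_eq_iff:
  assumes "A \<in> Obj C" "B \<in> Obj C" "f \<in> Hom C A B" "g \<in> Hom C A B"
  shows "quotient_class C I A B f = quotient_class C I A B g
    \<longleftrightarrow> (\<exists>i \<in> I A B. f = Add C A B i g)"
proof -
  interpret G: group "hom_group C A B" using assms by (simp add: hom_group_is_group)
  have "quotient_class C I A B f = quotient_class C I A B g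
    \<longleftrightarrow> f \<in> quotient_class C I A B g"
    using assms G.repr_independence[of f "I A B" g] G.repr_independenceD[of "I A B" f g]
      subgroup_ideal[of A B]
    by (auto simp: quotient_class_def)
  then show ?thesis by (simp add: mem_quotient_class_iff)
qed

lemma quotient_class_self:
  assumes "A \<in> Obj C" "B \<in> Obj C" "f \<in> Hom C A B"
  shows "f \<in> quotient_class C I A B f"
  using group.rcos_self[OF hom_group_is_group] subgroup_ideal assms
  by (simp add: quotient_class_def)

text \<open>The zero of the factor group is the subgroup \<open>I A B\<close> itself, and a coset
  equals its subgroup exactly when its representative lies in it.\<close>

lemma quotient_class_eq_Zero_iff:
  assumes "A \<in> Obj C" "B \<in> Obj C" "f \<in> Hom C A B"
  shows "quotient_class C I A B f = Zero (quotient_category C I) A B \<longleftrightarrow> f \<in> I A B"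
  using group.coset_join1[OF hom_group_is_group, of A B "I A B" f]
    group.coset_join2[OF hom_group_is_group, of A B f "I A B"] subgroup_ideal assms
  by (auto simp: quotient_class_def quotient_category_def)

lemma Obj_quotient: "Obj (quotient_category C I) = Obj C"
  by (simp add: quotient_category_def)

lemma Hom_quotient:
  "Hom (quotient_category C I) A B = {quotient_class C I A B f | f. f \<in> Hom C A B}"
  by (auto simp add: quotient_category_def carrier_FactGroup quotient_class_def)

text \<open>Changing the representatives to \<open>i + f\<close> and \<open>j + g\<close> changes
  the composite by \<open>f' j + i g\<close>, which is in the ideal. The union defining the
  composite therefore ranges over equal classes.\<close>

lemma Comp_quotient:
  assumes O: "A \<in> Obj C" "B \<in> Obj C" "D \<in> Obj C"
    and f: "f \<in> Hom C A B" and g: "g \<in> Hom C B D"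
  shows "Comp (quotient_category C I) A B D (quotient_class C I A B f) (quotient_class C I B D g)
    = quotient_class C I A D (Comp C A B D f g)"
proof -
  have "quotient_class C I A D (Comp C A B D f' g') = quotient_class C I A D (Comp C A B D f g)"
    if mem: "f' \<in> quotient_class C I A B f" "g' \<in> quotient_class C I B D g" for f' g'
  proof -
    obtain i j where i: "i \<in> I A B" "f' = Add C A B i f" and j: "j \<in> I B D" "g' = Add C B D j g"
      using mem by (auto simp: mem_quotient_class_iff)
    have ij: "i \<in> Hom C A B" "j \<in> Hom C B D" using i j O by (auto intro: ideal_subset)
    have f': "f' \<in> Hom C A B" using i(2) ij f O by (simp add: Add_closed)
    \<comment> \<open>Only \<open>g'\<close> is expanded at first; then \<open>f'\<close> is
      expanded in the summand ending in \<open>g\<close>, which gives two error terms instead of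
      three.\<close>
    have "Comp C A B D f' g'
        = Add C A D (Comp C A B D f' j) (Add C A D (Comp C A B D i g) (Comp C A B D f g))"
      unfolding j(2) using f' ij f g O by (simp add: Comp_Add_right) (simp add: i(2) Comp_Add_left)
    also have "\<dots> = Add C A D (Add C A D (Comp C A B D f' j) (Comp C A B D i g)) (Comp C A B D f g)"
      using f' ij f g O by (simp add: Add_assoc Comp_closed)
    finally have "Comp C A B D f' g' = \<dots>" .
    moreover have "Add C A D (Comp C A B D f' j) (Comp C A B D i g) \<in> I A D"
      by (intro ideal_Add_closed Comp_ideal_left[OF O i(1) g] Comp_ideal_right[OF O f' j(1)] O)
    ultimately have "\<exists>k \<in> I A D. Comp C A B D f' g' = Add C A D k (Comp C A B D f g)" by blast
    moreover have "g' \<in> Hom C B D" using j(2) ij g O by (simp add: Add_closed)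
    ultimately show ?thesis
      using f' f g O by (simp add: quotient_class_eq_iff Comp_closed)
  qed
  then have "Comp (quotient_category C I) A B D (quotient_class C I A B f) (quotient_class C I B D g)
    = (\<Union>f' \<in> quotient_class C I A B f. \<Union>g' \<in> quotient_class C I B D g.
        quotient_class C I A D (Comp C A B D f g))"
    by (simp add: quotient_category_def cong: SUP_cong)
  also have "\<dots> = quotient_class C I A D (Comp C A B D f g)"
    \<comment> \<open>A constant union collapses because both index sets are nonempty.\<close>
    using quotient_class_self[OF O(1,2) f] quotient_class_self[OF O(2,3) g] by blast
  finally show ?thesis .
qed

end


section \<open>Syzygies and the auxiliary category\<close>

lemma mem_cospans_iff:
  "X \<in> cospans P \<longleftrightarrow> csrc X \<in> Obj P \<and> capex X \<in> Obj P \<and> crel X \<in> Obj P \<and>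
    cgamma X \<in> Hom P (csrc X) (capex X) \<and> crho X \<in> Hom P (crel X) (capex X)"
  by (cases X) (auto simp: cospans_def)

text \<open>Fixing the source \<open>S\<close> places the syzygies inside a single hom group, where
  subgroup arguments apply. \<open>Obj_Syz\<close> is the link to the objects of the category
  \<open>Syz\<close>.\<close>

definition syzygies ::
  "('o, 'm, 'x) cat_scheme \<Rightarrow> 'o \<Rightarrow> ('o, 'm) cospan \<Rightarrow> 'm set" where
  "syzygies P S X = {\<sigma> \<in> Hom P S (csrc X). \<exists>\<omega> \<in> Hom P S (crel X).
     Comp P S (csrc X) (capex X) \<sigma> (cgamma X) = Comp P S (crel X) (capex X) \<omega> (crho X)}"

lemma Obj_Syz: "(S, \<sigma>) \<in> Obj (Syz P X) \<longleftrightarrow> S \<in> Obj P \<and> \<sigma> \<in> syzygies P S X"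
  by (auto simp: Syz_def full_subcategory_def slice_category_def syzygies_def)

lemma Aux_simps [simp]:
  "Obj (Aux P) = cospans P"
  "Ident (Aux P) X = Ident P (csrc X)"
  "Comp (Aux P) X Y Z = Comp P (csrc X) (csrc Y) (csrc Z)"
  "Add (Aux P) X Y = Add P (csrc X) (csrc Y)"
  "Zero (Aux P) X Y = Zero P (csrc X) (csrc Y)"
  by (simp_all add: Aux_def)

lemma mem_Hom_Aux_iff:
  "\<alpha> \<in> Hom (Aux P) X Y \<longleftrightarrow> \<alpha> \<in> Hom P (csrc X) (csrc Y) \<and>
    (\<forall>S \<in> Obj P. \<forall>\<sigma> \<in> syzygies P S X. Comp P S (csrc X) (csrc Y) \<sigma> \<alpha> \<in> syzygies P S Y)"
  by (auto simp: Aux_def Obj_Syz)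

section \<open>Group structure on syzygies, and the ideal of \<open>Aux\<close>\<close>

context preadditive_category
begin

text \<open>Composition with \<gamma> and composition with \<rho> are group homomorphisms into the
  same hom group. The syzygies are the preimage under the first of the image of the second.\<close>

lemma subgroup_syzygies:
  assumes S: "S \<in> Obj C" and X: "X \<in> cospans C"
  shows "subgroup (syzygies C S X) (hom_group C S (csrc X))"
proof -
  have O: "csrc X \<in> Obj C" "capex X \<in> Obj C" "crel X \<in> Obj C"
    and m: "cgamma X \<in> Hom C (csrc X) (capex X)" "crho X \<in> Hom C (crel X) (capex X)"
    using X by (auto simp: mem_cospans_iff)
  interpret g: group_hom "hom_group C S (csrc X)" "hom_group C S (capex X)"
    "\<lambda>\<sigma>. Comp C S (csrc X) (capex X) \<sigma> (cgamma X)"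
    using S O m by (simp add: group_hom_postcomp)
  interpret r: group_hom "hom_group C S (crel X)" "hom_group C S (capex X)"
    "\<lambda>\<omega>. Comp C S (crel X) (capex X) \<omega> (crho X)"
    using S O m by (simp add: group_hom_postcomp)
  let ?W = "(\<lambda>\<omega>. Comp C S (crel X) (capex X) \<omega> (crho X)) ` carrier (hom_group C S (crel X))"
  have eq: "syzygies C S X = {\<sigma> \<in> carrier (hom_group C S (csrc X)).
      Comp C S (csrc X) (capex X) \<sigma> (cgamma X) \<in> ?W}"
    by (auto simp: syzygies_def)
  have W: "subgroup ?W (hom_group C S (capex X))" by (rule r.img_is_subgroup)
  show ?thesis
    unfolding eq
  proof (rule g.G.subgroupI, goal_cases)
    case 2
    then show ?case using g.G.one_closed g.hom_one subgroup.one_closed[OF W] by force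
  next
    case (3 a)
    then show ?case using g.G.inv_closed g.hom_inv subgroup.m_inv_closed[OF W] by simp
  next
    case (4 a b)
    then show ?case using g.G.m_closed g.hom_mult subgroup.m_closed[OF W]
      by (simp del: hom_group_simps)
  qed blast
qed

lemma syzygies_subset: "\<sigma> \<in> syzygies C S X \<Longrightarrow> \<sigma> \<in> Hom C S (csrc X)"
  by (simp add: syzygies_def)

lemma Add_syzygies:
  assumes "S \<in> Obj C" "X \<in> cospans C" "\<sigma> \<in> syzygies C S X" "\<sigma>' \<in> syzygies C S X"
  shows "Add C S (csrc X) \<sigma> \<sigma>' \<in> syzygies C S X"
  using subgroup.m_closed[OF subgroup_syzygies] assms by simp

text \<open>Precomposing a witness of \<sigma> with \<open>f\<close> gives a witness of the
  composite.\<close>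

lemma Comp_syzygies:
  assumes "S \<in> Obj C" "A \<in> Obj C" and X: "X \<in> cospans C"
    and f: "f \<in> Hom C S A" and "\<sigma> \<in> syzygies C A X"
  shows "Comp C S A (csrc X) f \<sigma> \<in> syzygies C S X"
proof -
  obtain \<omega> where "\<omega> \<in> Hom C A (crel X)" "\<sigma> \<in> Hom C A (csrc X)"
    "Comp C A (csrc X) (capex X) \<sigma> (cgamma X) = Comp C A (crel X) (capex X) \<omega> (crho X)"
    using assms by (auto simp: syzygies_def)
  then have "Comp C S A (crel X) f \<omega> \<in> Hom C S (crel X)"
    "Comp C S A (csrc X) f \<sigma> \<in> Hom C S (csrc X)"
    "Comp C S (csrc X) (capex X) (Comp C S A (csrc X) f \<sigma>) (cgamma X) =
     Comp C S (crel X) (capex X) (Comp C S A (crel X) f \<omega>) (crho X)"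
    using assms by (auto simp: mem_cospans_iff Comp_closed Comp_assoc)
  then show ?thesis by (auto simp: syzygies_def)
qed

text \<open>Any morphism followed by the syzygy \<alpha> is again a syzygy of \<open>Y\<close>, by
  \<open>Comp_syzygies\<close>; this applies in particular to the syzygies of
  \<open>X\<close>.\<close>

lemma syzygies_subset_Hom_Aux:
  assumes "X \<in> cospans C" "Y \<in> cospans C" "\<alpha> \<in> syzygies C (csrc X) Y"
  shows "\<alpha> \<in> Hom (Aux C) X Y"
  using assms by (auto simp: mem_Hom_Aux_iff mem_cospans_iff intro: Comp_syzygies syzygies_subset)

text \<open>The morphism \<zeta> in the ideal is a syzygy witness for \<alpha>, and conversely
  \<open>syzygies_subset_Hom_Aux\<close> supplies well-definedness. The right-hand side sees only
  the underlying object of \<open>X\<close>, which later lets ideals from different cospans be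
  compared.\<close>

lemma aux_ideal_eq_syzygies:
  assumes "X \<in> cospans C" "Y \<in> cospans C"
  shows "aux_ideal C X Y = syzygies C (csrc X) Y"
proof -
  have "aux_ideal C X Y = {\<alpha> \<in> Hom (Aux C) X Y. \<alpha> \<in> syzygies C (csrc X) Y}"
    by (auto simp: aux_ideal_def syzygies_def mem_Hom_Aux_iff)
  then show ?thesis using syzygies_subset_Hom_Aux[OF assms] by blast
qed

text \<open>Each syzygy \<sigma> of \<open>X\<close> imposes that the image of \<alpha> under
  precomposition with \<sigma> lies in the subgroup of syzygies of \<open>Y\<close>. An intersection
  of such preimages is a subgroup.\<close>

lemma subgroup_Hom_Aux:
  assumes X: "X \<in> cospans C" and Y: "Y \<in> cospans C"
  shows "subgroup (Hom (Aux C) X Y) (hom_group C (csrc X) (csrc Y))"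
proof -
  have O: "csrc X \<in> Obj C" "csrc Y \<in> Obj C" using X Y by (auto simp: mem_cospans_iff)
  interpret G: group "hom_group C (csrc X) (csrc Y)" using O by (simp add: hom_group_is_group)
  have h: "group_hom (hom_group C (csrc X) (csrc Y)) (hom_group C S (csrc Y))
      (Comp C S (csrc X) (csrc Y) \<sigma>)"
    if "S \<in> Obj C" "\<sigma> \<in> syzygies C S X" for S \<sigma>
    using that O by (auto intro: group_hom_precomp syzygies_subset)
  have sub: "subgroup (syzygies C S Y) (hom_group C S (csrc Y))" if "S \<in> Obj C" for S
    using that Y by (rule subgroup_syzygies)
  show ?thesis
  proof (rule G.subgroupI)
    show "Hom (Aux C) X Y \<subseteq> carrier (hom_group C (csrc X) (csrc Y))"
      by (auto simp: mem_Hom_Aux_iff)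
    have "\<one>\<^bsub>hom_group C (csrc X) (csrc Y)\<^esub> \<in> Hom (Aux C) X Y"
      unfolding mem_Hom_Aux_iff
      using group_hom.hom_one[OF h] subgroup.one_closed[OF sub] Zero_closed[OF O] by simp
    then show "Hom (Aux C) X Y \<noteq> {}" by blast
  next
    fix a assume "a \<in> Hom (Aux C) X Y"
    then show "inv\<^bsub>hom_group C (csrc X) (csrc Y)\<^esub> a \<in> Hom (Aux C) X Y"
      unfolding mem_Hom_Aux_iff
      using group_hom.hom_inv[OF h, of _ _ a] subgroup.m_inv_closed[OF sub] G.inv_closed[of a]
      by simp
  next
    fix a b assume "a \<in> Hom (Aux C) X Y" "b \<in> Hom (Aux C) X Y"
    then show "a \<otimes>\<^bsub>hom_group C (csrc X) (csrc Y)\<^esub> b \<in> Hom (Aux C) X Y"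
      unfolding mem_Hom_Aux_iff
      using group_hom.hom_mult[OF h, of _ _ a b] subgroup.m_closed[OF sub] G.m_closed[of a b]
      by simp
  qed
qed

text \<open>Restricting the carrier is the form in which general results on subgroups describe the
  group structure of a subgroup.\<close>

lemma hom_group_Aux:
  "hom_group (Aux C) X Y = (hom_group C (csrc X) (csrc Y))\<lparr>carrier := Hom (Aux C) X Y\<rparr>"
  by (simp add: hom_group_def)

text \<open>Two cospans are allowed here because this serves both the identities of
  \<open>Aux\<close> and the cokernel projection.\<close>

lemma Ident_mem_Hom_Aux:
  assumes "csrc X = csrc Y" "csrc X \<in> Obj C"
    and "\<And>S. S \<in> Obj C \<Longrightarrow> syzygies C S X \<subseteq> syzygies C S Y"
  shows "Ident C (csrc X) \<in> Hom (Aux C) X Y"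
  unfolding mem_Hom_Aux_iff
proof (intro conjI ballI)
  show "Ident C (csrc X) \<in> Hom C (csrc X) (csrc Y)" using assms Ident_closed by simp
  fix S \<sigma> assume S: "S \<in> Obj C" and \<sigma>: "\<sigma> \<in> syzygies C S X"
  have "Comp C S (csrc X) (csrc X) \<sigma> (Ident C (csrc X)) = \<sigma>"
    using S assms(2) syzygies_subset[OF \<sigma>] by (rule Ident_right)
  then show "Comp C S (csrc X) (csrc Y) \<sigma> (Ident C (csrc X)) \<in> syzygies C S Y"
    using assms S \<sigma> by auto
qed

lemma preadditive_category_Aux: "preadditive_category (Aux C)"
proof (intro preadditive_category.intro category.intro preadditive_category_axioms.intro,
    goal_cases)
  case (1 A)
  then show ?case by (simp add: Ident_mem_Hom_Aux mem_cospans_iff)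
next
  case (2 A B D f g)
  then show ?case
    unfolding mem_Hom_Aux_iff by (auto simp: mem_cospans_iff Comp_closed)
      (metis Comp_assoc syzygies_subset)
next
  case (3 A B D E f g h)
  then show ?case by (simp add: mem_Hom_Aux_iff mem_cospans_iff Comp_assoc)
next
  case (4 A B f)
  then show ?case by (simp add: mem_Hom_Aux_iff mem_cospans_iff Ident_left)
next
  case (5 A B f)
  then show ?case by (simp add: mem_Hom_Aux_iff mem_cospans_iff Ident_right)
next
  case (6 A B)
  then have O: "csrc A \<in> Obj C" "csrc B \<in> Obj C" by (auto simp: mem_cospans_iff)
  \<comment> \<open>Commutativity is inherited from the ambient hom group, inverses come from the
    subgroup.\<close>
  interpret G: comm_group "hom_group C (csrc A) (csrc B)" using O by (rule hom_comm_group)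
  have sub: "subgroup (Hom (Aux C) A B) (hom_group C (csrc A) (csrc B))"
    using 6 by (simp add: subgroup_Hom_Aux)
  show ?case
    unfolding hom_group_Aux
    by (rule comm_group.intro
        [OF G.submonoid_is_comm_monoid[OF subgroup.subgroup_is_submonoid[OF sub]]
          subgroup.subgroup_is_group[OF sub G.is_group]])
next
  case (7 A B D f g h)
  then show ?case by (simp add: mem_Hom_Aux_iff mem_cospans_iff Comp_Add_left)
next
  case (8 A B D f g h)
  then show ?case by (simp add: mem_Hom_Aux_iff mem_cospans_iff Comp_Add_right)
qed

text \<open>With ideal elements read as syzygies, closure under a following morphism is the
  well-definedness property of that morphism applied to the ideal element. Closure under a preceding
  morphism is \<open>Comp_syzygies\<close>.\<close>

lemma category_ideal_aux: "category_ideal (Aux C) (aux_ideal C)"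
proof (intro category_ideal.intro category_ideal_axioms.intro preadditive_category_Aux, goal_cases)
  case (1 X Y)
  then have XY: "X \<in> cospans C" "Y \<in> cospans C" by simp_all
  then have O: "csrc X \<in> Obj C" "csrc Y \<in> Obj C" by (auto simp: mem_cospans_iff)
  show ?case
    unfolding hom_group_Aux aux_ideal_eq_syzygies[OF XY]
    using syzygies_subset_Hom_Aux[OF XY]
    by (intro group.subgroup_incl hom_group_is_group subgroup_syzygies subgroup_Hom_Aux XY O) blast
next
  case (2 X Y Z f g)
  then show ?case
    by (simp add: aux_ideal_eq_syzygies mem_Hom_Aux_iff) (simp add: mem_cospans_iff)
next
  case (3 X Y Z f g)
  then show ?case
    by (auto simp: aux_ideal_eq_syzygies mem_Hom_Aux_iff mem_cospans_iff intro!: Comp_syzygies)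
qed

end

section \<open>The cokernel of a morphism in \<open>Q P\<close>\<close>

theorem mainTheorem6:
  fixes P :: "('o, 'm, 'x) preadd_cat_scheme"
    and A \<Omega>\<^sub>A R\<^sub>A B \<Omega>\<^sub>B R\<^sub>B D :: 'o
    and \<gamma>\<^sub>A \<rho>\<^sub>A \<gamma>\<^sub>B \<rho>\<^sub>B \<alpha> \<iota>\<^sub>1 \<iota>\<^sub>2 \<pi>\<^sub>1 \<pi>\<^sub>2 :: 'm
    and X Y K :: "('o, 'm) cospan"
  assumes "additive_category P"
    and X: "X = Cospan A \<Omega>\<^sub>A R\<^sub>A \<gamma>\<^sub>A \<rho>\<^sub>A" "X \<in> Obj (Q P)"
    and Y: "Y = Cospan B \<Omega>\<^sub>B R\<^sub>B \<gamma>\<^sub>B \<rho>\<^sub>B" "Y \<in> Obj (Q P)"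
    and \<alpha>: "\<alpha> \<in> Hom (Aux P) X Y"
    and sum: "is_direct_sum P R\<^sub>B A D \<iota>\<^sub>1 \<iota>\<^sub>2 \<pi>\<^sub>1 \<pi>\<^sub>2"
    and K: "K = Cospan B \<Omega>\<^sub>B D \<gamma>\<^sub>B
              (row_morphism P R\<^sub>B A D \<iota>\<^sub>1 \<iota>\<^sub>2 \<Omega>\<^sub>B \<rho>\<^sub>B (Comp P A B \<Omega>\<^sub>B \<alpha> \<gamma>\<^sub>B))"
  shows "K \<in> Obj (Q P) \<and>
    Ident P B \<in> Hom (Aux P) Y K \<and>
    is_cokernel (Q P) X Y (Q_class P X Y \<alpha>) K (Q_class P Y K (Ident P B)) \<and>
    (\<forall>T \<in> Obj (Q P). \<forall>\<tau> \<in> Hom (Aux P) Y T.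
       Comp (Q P) X Y T (Q_class P X Y \<alpha>) (Q_class P Y T \<tau>) = Zero (Q P) X T \<longrightarrow>
       \<tau> \<in> Hom (Aux P) K T \<and>
       (\<forall>u. u \<in> Hom (Q P) K T \<and>
             Comp (Q P) Y K T (Q_class P Y K (Ident P B)) u = Q_class P Y T \<tau>
            \<longleftrightarrow> u = Q_class P K T \<tau>))"
proof -
  interpret P: additive_category P by fact
  interpret A: category_ideal "Aux P" "aux_ideal P" by (rule P.category_ideal_aux)
  \<comment> \<open>These reduce statements about classes in \<open>Q P\<close> to statements about
    representatives modulo \<open>aux_ideal P\<close>.\<close>
  note QP = A.Obj_quotient[folded Q_def] A.Hom_quotient[folded Q_def Q_class_def]
    A.Comp_quotient[folded Q_def Q_class_def]
    A.quotient_class_eq_Zero_iff[folded Q_def Q_class_def]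
    A.quotient_class_eq_iff[folded Q_class_def]
  let ?\<rho> = "row_morphism P R\<^sub>B A D \<iota>\<^sub>1 \<iota>\<^sub>2 \<Omega>\<^sub>B \<rho>\<^sub>B (Comp P A B \<Omega>\<^sub>B \<alpha> \<gamma>\<^sub>B)"
  have XY: "X \<in> cospans P" "Y \<in> cospans P" using X(2) Y(2) by (simp_all add: QP)
  have O: "A \<in> Obj P" "B \<in> Obj P" "\<Omega>\<^sub>B \<in> Obj P" "R\<^sub>B \<in> Obj P"
    and m: "\<gamma>\<^sub>B \<in> Hom P B \<Omega>\<^sub>B" "\<rho>\<^sub>B \<in> Hom P R\<^sub>B \<Omega>\<^sub>B" "\<alpha> \<in> Hom P A B"
    using XY \<alpha> by (simp_all add: mem_cospans_iff mem_Hom_Aux_iff X(1) Y(1))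
  have D: "D \<in> Obj P" "\<iota>\<^sub>1 \<in> Hom P R\<^sub>B D" "\<iota>\<^sub>2 \<in> Hom P A D" "\<pi>\<^sub>1 \<in> Hom P D R\<^sub>B" "\<pi>\<^sub>2 \<in> Hom P D A"
    using sum by (auto simp: is_direct_sum_def)
  have \<alpha>\<gamma>: "Comp P A B \<Omega>\<^sub>B \<alpha> \<gamma>\<^sub>B \<in> Hom P A \<Omega>\<^sub>B" using O m by (simp add: P.Comp_closed)
  note row = P.row_morphism[OF O(4,1,3) sum m(2) \<alpha>\<gamma>]
  have KC: "K \<in> cospans P" by (simp add: K mem_cospans_iff O m D row)
  have src [simp]: "csrc X = A" "csrc Y = B" "csrc K = B" by (simp_all add: X Y K)

  \<comment> \<open>A witness for \<open>Y\<close> becomes one for \<open>K\<close> after the first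
    injection, because that injection followed by the row morphism is
    \<open>\<rho>\<^sub>B\<close>.\<close>
  have "syzygies P S Y \<subseteq> syzygies P S K" if S: "S \<in> Obj P" for S
  proof
    fix \<sigma> assume "\<sigma> \<in> syzygies P S Y"
    then obtain \<omega> where \<sigma>: "\<sigma> \<in> Hom P S B" and \<omega>: "\<omega> \<in> Hom P S R\<^sub>B"
      and eq: "Comp P S B \<Omega>\<^sub>B \<sigma> \<gamma>\<^sub>B = Comp P S R\<^sub>B \<Omega>\<^sub>B \<omega> \<rho>\<^sub>B"
      by (auto simp: syzygies_def Y)
    have "Comp P S D \<Omega>\<^sub>B (Comp P S R\<^sub>B D \<omega> \<iota>\<^sub>1) ?\<rho> = Comp P S B \<Omega>\<^sub>B \<sigma> \<gamma>\<^sub>B"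
      using S O D \<omega> row by (simp add: P.Comp_assoc eq)
    moreover have "Comp P S R\<^sub>B D \<omega> \<iota>\<^sub>1 \<in> Hom P S D" using S O D \<omega> by (simp add: P.Comp_closed)
    ultimately show "\<sigma> \<in> syzygies P S K" using \<sigma> unfolding syzygies_def K by force
  qed
  then have "Ident P (csrc Y) \<in> Hom (Aux P) Y K" using O by (intro P.Ident_mem_Hom_Aux) simp_all
  then have idK: "Ident P B \<in> Hom (Aux P) Y K" by simp

  \<comment> \<open>The second injection is a witness: the second component of the row morphism was
    chosen as \<alpha> followed by \<open>\<gamma>\<^sub>B\<close>. This puts \<alpha> in the ideal
    and kills the composite with the projection.\<close>
  have "\<alpha> \<in> syzygies P A K"
    using m(3) row(3) D(3) by (auto simp: syzygies_def K intro!: bexI[of _ \<iota>\<^sub>2])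
  then have "\<alpha> \<in> aux_ideal P X K" by (simp add: P.aux_ideal_eq_syzygies XY KC)
  moreover have "Comp P A B B \<alpha> (Ident P B) = \<alpha>" using O m by (simp add: P.Ident_right)
  ultimately have zero: "Comp (Q P) X Y K (Q_class P X Y \<alpha>) (Q_class P Y K (Ident P B)) = Zero (Q P) X K"
    using XY KC \<alpha> idK by (simp add: QP) (metis QP(4) Aux_simps(1) P.syzygies_subset_Hom_Aux
        P.aux_ideal_eq_syzygies)

  \<comment> \<open>Vanishing of the composite class enters as the assumption that \<alpha> followed
    by \<tau> is a syzygy of \<open>T\<close>; it controls the additional syzygies that
    \<open>K\<close> has over \<open>Y\<close>.\<close>
  have fact: "\<tau> \<in> Hom (Aux P) K T"
    if T: "T \<in> cospans P" and \<tau>: "\<tau> \<in> Hom (Aux P) Y T"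
      and 0: "Comp P A B (csrc T) \<alpha> \<tau> \<in> syzygies P A T" for T \<tau>
    unfolding mem_Hom_Aux_iff
  proof (intro conjI ballI)
    have T': "csrc T \<in> Obj P" using T by (simp add: mem_cospans_iff)
    show \<tau>P: "\<tau> \<in> Hom P (csrc K) (csrc T)" using \<tau> by (simp add: mem_Hom_Aux_iff)
    fix S \<sigma> assume S: "S \<in> Obj P" and "\<sigma> \<in> syzygies P S K"
    then obtain \<omega> where \<sigma>: "\<sigma> \<in> Hom P S B" and \<omega>: "\<omega> \<in> Hom P S D"
      and eq: "Comp P S B \<Omega>\<^sub>B \<sigma> \<gamma>\<^sub>B = Comp P S D \<Omega>\<^sub>B \<omega> ?\<rho>"
      by (auto simp: syzygies_def K)
    define \<omega>\<^sub>1 where "\<omega>\<^sub>1 = Comp P S D R\<^sub>B \<omega> \<pi>\<^sub>1"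
    define \<omega>\<^sub>2 where "\<omega>\<^sub>2 = Comp P S D A \<omega> \<pi>\<^sub>2"
    have \<omega>12: "\<omega>\<^sub>1 \<in> Hom P S R\<^sub>B" "\<omega>\<^sub>2 \<in> Hom P S A"
      using S O D \<omega> by (simp_all add: \<omega>\<^sub>1_def \<omega>\<^sub>2_def P.Comp_closed)
    define \<beta> where "\<beta> = Comp P S A B \<omega>\<^sub>2 \<alpha>"
    have \<beta>: "\<beta> \<in> Hom P S B" using S O m \<omega>12 by (simp add: \<beta>_def P.Comp_closed)
    interpret G: comm_group "hom_group P S B" using S O by (simp add: P.hom_comm_group)
    interpret H: comm_group "hom_group P S \<Omega>\<^sub>B" using S O by (simp add: P.hom_comm_group)
    interpret h: group_hom "hom_group P S B" "hom_group P S \<Omega>\<^sub>B" "\<lambda>f. Comp P S B \<Omega>\<^sub>B f \<gamma>\<^sub>B"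
      using S O m by (simp add: P.group_hom_postcomp)
    \<comment> \<open>Subtracting \<beta>, the part factoring through \<alpha>, cancels the
      contribution of \<open>\<omega>\<^sub>2\<close> and leaves \<open>\<omega>\<^sub>1\<close> as
      a witness over \<open>Y\<close>.\<close>
    let ?\<delta> = "\<sigma> \<otimes>\<^bsub>hom_group P S B\<^esub> inv\<^bsub>hom_group P S B\<^esub> \<beta>"
    have \<delta>: "?\<delta> \<in> Hom P S B" using \<sigma> \<beta> G.m_closed G.inv_closed by simp
    have "Comp P S B \<Omega>\<^sub>B \<sigma> \<gamma>\<^sub>B
        = Comp P S R\<^sub>B \<Omega>\<^sub>B \<omega>\<^sub>1 \<rho>\<^sub>B \<otimes>\<^bsub>hom_group P S \<Omega>\<^sub>B\<^esub> Comp P S B \<Omega>\<^sub>B \<beta> \<gamma>\<^sub>B"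
      using P.Comp_row_morphism[OF O(4,1,3) S sum m(2) \<alpha>\<gamma> \<omega>] S O m \<omega>12
      by (simp add: eq \<beta>_def P.Comp_assoc flip: \<omega>\<^sub>1_def \<omega>\<^sub>2_def)
    moreover have "Comp P S R\<^sub>B \<Omega>\<^sub>B \<omega>\<^sub>1 \<rho>\<^sub>B \<in> Hom P S \<Omega>\<^sub>B" "Comp P S B \<Omega>\<^sub>B \<beta> \<gamma>\<^sub>B \<in> Hom P S \<Omega>\<^sub>B"
      using S O m \<omega>12 \<beta> by (simp_all add: P.Comp_closed)
    ultimately have "Comp P S B \<Omega>\<^sub>B ?\<delta> \<gamma>\<^sub>B = Comp P S R\<^sub>B \<Omega>\<^sub>B \<omega>\<^sub>1 \<rho>\<^sub>B"
      using h.hom_mult[of \<sigma> "inv\<^bsub>hom_group P S B\<^esub> \<beta>"] h.hom_inv[of \<beta>] G.inv_closed[of \<beta>] \<sigma> \<beta>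
        H.inv_solve_right'[of "Comp P S R\<^sub>B \<Omega>\<^sub>B \<omega>\<^sub>1 \<rho>\<^sub>B" "Comp P S B \<Omega>\<^sub>B \<sigma> \<gamma>\<^sub>B" "Comp P S B \<Omega>\<^sub>B \<beta> \<gamma>\<^sub>B"]
        P.Add_closed[OF S O(3)]
      by (simp del: P.hom_group_simps(2)) (simp add: P.hom_group_simps(2))
    then have "?\<delta> \<in> syzygies P S Y" using \<delta> \<omega>12 unfolding syzygies_def Y by force
    then have "Comp P S B (csrc T) ?\<delta> \<tau> \<in> syzygies P S T"
      using \<tau> S by (simp add: mem_Hom_Aux_iff)
    \<comment> \<open>Reassociated, this is \<open>\<omega>\<^sub>2\<close> followed by the syzygy
      \<alpha> \<tau> of \<open>T\<close>.\<close>
    moreover have "Comp P S B (csrc T) \<beta> \<tau> \<in> syzygies P S T"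
      using P.Comp_syzygies[OF S O(1) T \<omega>12(2) 0] S O m \<omega>12 T' \<tau>P
      by (simp add: \<beta>_def P.Comp_assoc)
    ultimately have "Add P S (csrc T) (Comp P S B (csrc T) ?\<delta> \<tau>) (Comp P S B (csrc T) \<beta> \<tau>)
        \<in> syzygies P S T"
      using S T by (simp add: P.Add_syzygies)
    moreover have "Add P S (csrc T) (Comp P S B (csrc T) ?\<delta> \<tau>) (Comp P S B (csrc T) \<beta> \<tau>)
        = Comp P S B (csrc T) (Add P S B ?\<delta> \<beta>) \<tau>"
      using S O T' \<delta> \<beta> \<tau>P by (simp add: P.Comp_Add_left)
    moreover have "Add P S B ?\<delta> \<beta> = \<sigma>"
      using G.inv_solve_right'[of ?\<delta> \<sigma> \<beta>] \<sigma> \<beta> \<delta> by simp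
    ultimately show "Comp P S (csrc K) (csrc T) \<sigma> \<tau> \<in> syzygies P S T" by simp
  qed

  have main: "\<tau> \<in> Hom (Aux P) K T \<and>
      (\<forall>u. u \<in> Hom (Q P) K T \<and>
         Comp (Q P) Y K T (Q_class P Y K (Ident P B)) u = Q_class P Y T \<tau>
         \<longleftrightarrow> u = Q_class P K T \<tau>)"
    if T: "T \<in> Obj (Q P)" and \<tau>: "\<tau> \<in> Hom (Aux P) Y T"
      and 0: "Comp (Q P) X Y T (Q_class P X Y \<alpha>) (Q_class P Y T \<tau>) = Zero (Q P) X T" for T \<tau>
  proof -
    have TC: "T \<in> cospans P" and T': "csrc T \<in> Obj P" using T by (simp_all add: QP mem_cospans_iff)
    have c: "Comp P A B (csrc T) \<alpha> \<tau> \<in> Hom (Aux P) X T"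
      using A.Comp_closed[of X Y T \<alpha> \<tau>] XY TC \<alpha> \<tau> by simp
    have "Comp P A B (csrc T) \<alpha> \<tau> \<in> syzygies P A T"
      using 0 XY TC \<alpha> \<tau> c by (simp add: QP P.aux_ideal_eq_syzygies)
    then have \<tau>K: "\<tau> \<in> Hom (Aux P) K T" using TC \<tau> by (intro fact)
    \<comment> \<open>Composing with the projection keeps the representative and only changes the
      source cospan of its class.\<close>
    have comp: "Comp (Q P) Y K T (Q_class P Y K (Ident P B)) (Q_class P K T \<beta>) = Q_class P Y T \<beta>"
      "\<beta> \<in> Hom (Aux P) Y T"
      if \<beta>: "\<beta> \<in> Hom (Aux P) K T" for \<beta>
    proof -
      have "Comp P B B (csrc T) (Ident P B) \<beta> = \<beta>"
        using \<beta> O T' by (simp add: mem_Hom_Aux_iff P.Ident_left)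
      then show "Comp (Q P) Y K T (Q_class P Y K (Ident P B)) (Q_class P K T \<beta>) = Q_class P Y T \<beta>"
        "\<beta> \<in> Hom (Aux P) Y T"
        using A.Comp_closed[of Y K T "Ident P B" \<beta>] XY KC TC idK \<beta> by (simp_all add: QP)
    qed
    \<comment> \<open>Both equalities say that \<beta> and \<tau> differ by a syzygy of
      \<open>T\<close> with source \<open>B\<close>. Left to right this is uniqueness of the induced
      morphism.\<close>
    have "Q_class P Y T \<beta> = Q_class P Y T \<tau> \<longleftrightarrow> Q_class P K T \<beta> = Q_class P K T \<tau>"
      if \<beta>: "\<beta> \<in> Hom (Aux P) K T" for \<beta>
      using \<beta> comp(2)[OF \<beta>] \<tau> \<tau>K XY KC TC by (simp add: QP P.aux_ideal_eq_syzygies)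
    then show ?thesis using \<tau>K comp by (auto simp: QP(2))
  qed

  have "is_cokernel (Q P) X Y (Q_class P X Y \<alpha>) K (Q_class P Y K (Ident P B))"
    unfolding is_cokernel_def
  proof (intro conjI ballI impI zero)
    show "K \<in> Obj (Q P)" using KC by (simp add: QP)
    show "Q_class P Y K (Ident P B) \<in> Hom (Q P) Y K" using idK by (auto simp: QP(2))
    fix T t assume T: "T \<in> Obj (Q P)" and t: "t \<in> Hom (Q P) Y T"
      and 0: "Comp (Q P) X Y T (Q_class P X Y \<alpha>) t = Zero (Q P) X T"
    obtain \<tau> where \<tau>: "\<tau> \<in> Hom (Aux P) Y T" and [simp]: "t = Q_class P Y T \<tau>"
      using t by (auto simp: QP)
    show "\<exists>!u. u \<in> Hom (Q P) K T \<and> Comp (Q P) Y K T (Q_class P Y K (Ident P B)) u = t"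
      using main[OF T \<tau>] 0 by auto
  qed
  then show ?thesis using KC idK main by (auto simp: QP(1))
qed

end
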